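(* Let $(R,\mathfrak{m})$ be a quasi-unmixed local ring with infinite residue field and $\dim R\geq 1$. Let $I$ be an equimultiple ideal of $R$ with analytic spread $s=s(I)$. Then for every $1\le k\le s$ the $k$-th equimultiple coefficient ideal of $I^{u}$ is $(I^{u})_k=(I_k)^{u}$, and every equimultiple coefficient ideal $I_k$ ($1\le k\le s$) of $I$ is an unmixed ideal.
   Context: Rings are commutative and Noetherian. A local ring $(R,\mathfrak m)$ is quasi-unmixed if its completion is equidimensional. The analytic spread of a proper ideal $I$ is $s(I)=\dim\bigoplus_{n\ge0}I^n/\mathfrak mI^n$, and $I$ is equimultiple if $\mathrm{ht}(I)=s(I)$. $\mathrm{Min}(R/I)$ is the set of minimal primes over $I$; for $I$ equimultiple, every $\mathfrak p\in\mathrm{Min}(R/I)$ satisfies $\dim R_{\mathfrak p}=s$, and $I_{\mathfrak p}=IR_{\mathfrak p}$ is primary to the maximal ideal of $R_{\mathfrak p}$. For an ideal $Q$ primary to the maximal ideal of a local ring $A$ of dimension $s$, the Hilbert coefficients $e_i(Q)$, $0\le i\le s$, are the integers with $\ell(A/Q^n)=\sum_{i=0}^s(-1)^ie_i(Q)\binom{n+s-i-1}{s-i}$ for all large $n$. For $1\le k\le s$, the $k$-th equimultiple coefficient ideal $I_k$ is the unique largest ideal $L\supseteq I$ such that $e_i(I_{\mathfrak p})=e_i(L_{\mathfrak p})$ for all $0\le i\le k$ and all $\mathfrak p\in\mathrm{Min}(R/I)$ (in particular $L_{\mathfrak p}$ is proper); the same definition is applied to $I^u$ in place of $I$. For an ideal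 $J$, $J^u$ denotes the unmixed part of $J$: the intersection of the primary components of $J$ belonging to the minimal primes of $J$; $J$ is unmixed if $J=J^u$, i.e. $R/J$ has no embedded associated primes. *)

theory Defs
  imports "HOL-Algebra.Ring_Divisibility" "HOL-Algebra.Ideal_Product" "HOL-Algebra.Module"
    "HOL-Library.Extended_Nat"
begin

section \<open>Local rings, minimal primes, dimension and height\<close>

locale noetherian_local_ring = cring R + noetherian_ring R + maximalideal m R
  for R (structure) and m +
  assumes unique_maximal: "maximalideal M R \<Longrightarrow> M = m"

abbreviation ideal_pow :: "('a, 'b) ring_scheme \<Rightarrow> 'a set \<Rightarrow> nat \<Rightarrow> 'a set" where
  "ideal_pow R I n \<equiv> I [^]\<^bsub>ideals_set R\<^esub> n"

definition min_primes :: "('a, 'b) ring_scheme \<Rightarrow> 'a set \<Rightarrow> 'a set set" where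
  "min_primes R I = {p. primeideal p R \<and> I \<subseteq> p \<and>
     (\<forall>q. primeideal q R \<and> I \<subseteq> q \<and> q \<subseteq> p \<longrightarrow> q = p)}"

definition prime_chain :: "('a, 'b) ring_scheme \<Rightarrow> (nat \<Rightarrow> 'a set) \<Rightarrow> nat \<Rightarrow> bool" where
  "prime_chain R P n \<longleftrightarrow> (\<forall>i\<le>n. primeideal (P i) R) \<and> (\<forall>i<n. P i \<subset> P (Suc i))"

definition krull_dim :: "('a, 'b) ring_scheme \<Rightarrow> enat" where
  "krull_dim R = Sup {enat n | n. \<exists>P. prime_chain R P n}"

definition prime_height :: "('a, 'b) ring_scheme \<Rightarrow> 'a set \<Rightarrow> enat" where
  "prime_height R p = Sup {enat n | n. \<exists>P. prime_chain R P n \<and> P n = p}"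

definition ideal_height :: "('a, 'b) ring_scheme \<Rightarrow> 'a set \<Rightarrow> enat" where
  "ideal_height R I = Inf {prime_height R p | p. primeideal p R \<and> I \<subseteq> p}"


section \<open>Completion and quasi-unmixed local rings\<close>

text \<open>The completion is the inverse limit of the rings \<open>R / m^n\<close>. The transition map sends a
  coset of \<open>m^(n+1)\<close> to the unique coset of \<open>m^n\<close> containing it, so compatibility of a
  sequence of cosets is an inclusion.\<close>

definition completion :: "('a, 'b) ring_scheme \<Rightarrow> 'a set \<Rightarrow> (nat \<Rightarrow> 'a set) ring" where
  "completion R m =
    \<lparr>carrier = {f. (\<forall>n. f n \<in> carrier (R Quot ideal_pow R m n)) \<and> (\<forall>n. f (Suc n) \<subseteq> f n)},
     monoid.mult = (\<lambda>f g n. f n \<otimes>\<^bsub>R Quot ideal_pow R m n\<^esub> g n),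
     one = (\<lambda>n. \<one>\<^bsub>R Quot ideal_pow R m n\<^esub>),
     ring.zero = (\<lambda>n. \<zero>\<^bsub>R Quot ideal_pow R m n\<^esub>),
     add = (\<lambda>f g n. f n \<oplus>\<^bsub>R Quot ideal_pow R m n\<^esub> g n)\<rparr>"

definition equidimensional :: "('a, 'b) ring_scheme \<Rightarrow> bool" where
  "equidimensional R \<longleftrightarrow> (\<forall>p \<in> min_primes R {\<zero>\<^bsub>R\<^esub>}. krull_dim (R Quot p) = krull_dim R)"

definition quasi_unmixed :: "('a, 'b) ring_scheme \<Rightarrow> 'a set \<Rightarrow> bool" where
  "quasi_unmixed R m \<longleftrightarrow> equidimensional (completion R m)"


section \<open>Analytic spread and equimultiple ideals\<close>

text \<open>The fiber cone \<open>\<Oplus>n. I^n / m I^n\<close>. The degree \<open>n\<close> component consists of the cosets of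
  \<open>m I^n\<close> in \<open>R\<close> that have a representative in \<open>I^n\<close>. The product of the cosets of \<open>x\<close>
  (degree \<open>i\<close>) and \<open>y\<close> (degree \<open>n - i\<close>) is the coset of \<open>x y\<close> modulo \<open>m I^n\<close>; it is computed
  by \<^const>\<open>rcoset_mult\<close>, a union over all representatives.\<close>

definition fiber_cone ::
    "('a, 'b) ring_scheme \<Rightarrow> 'a set \<Rightarrow> 'a set \<Rightarrow> (nat \<Rightarrow> 'a set) ring" where
  "fiber_cone R m I =
    (let N = (\<lambda>n. ideal_prod R m (ideal_pow R I n)) in
    \<lparr>carrier = {f. (\<forall>n. \<exists>x \<in> ideal_pow R I n. f n = N n +>\<^bsub>R\<^esub> x) \<and> finite {n. f n \<noteq> N n}},
     monoid.mult = (\<lambda>f g n. \<Oplus>\<^bsub>R Quot N n\<^esub> i \<in> {..n}. rcoset_mult R (N n) (f i) (g (n - i))),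
     one = (\<lambda>n. if n = 0 then N 0 +>\<^bsub>R\<^esub> \<one>\<^bsub>R\<^esub> else N n),
     ring.zero = N,
     add = (\<lambda>f g n. f n <+>\<^bsub>R\<^esub> g n)\<rparr>)"

definition analytic_spread :: "('a, 'b) ring_scheme \<Rightarrow> 'a set \<Rightarrow> 'a set \<Rightarrow> enat" where
  "analytic_spread R m I = krull_dim (fiber_cone R m I)"

definition equimultiple :: "('a, 'b) ring_scheme \<Rightarrow> 'a set \<Rightarrow> 'a set \<Rightarrow> bool" where
  "equimultiple R m I \<longleftrightarrow>
     ideal I R \<and> I \<noteq> carrier R \<and> ideal_height R I = analytic_spread R m I"


section \<open>Primary decomposition and the unmixed part\<close>

definition radical :: "('a, 'b) ring_scheme \<Rightarrow> 'a set \<Rightarrow> 'a set" where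
  "radical R I = {x \<in> carrier R. \<exists>n::nat. x [^]\<^bsub>R\<^esub> n \<in> I}"

definition primary_ideal :: "('a, 'b) ring_scheme \<Rightarrow> 'a set \<Rightarrow> bool" where
  "primary_ideal R Q \<longleftrightarrow> ideal Q R \<and> Q \<noteq> carrier R \<and>
     (\<forall>a \<in> carrier R. \<forall>b \<in> carrier R. a \<otimes>\<^bsub>R\<^esub> b \<in> Q \<longrightarrow> a \<in> Q \<or> b \<in> radical R Q)"

text \<open>Irredundant primary decompositions with pairwise distinct radicals. The unit ideal has
  the empty decomposition.\<close>

definition primary_decomposition :: "('a, 'b) ring_scheme \<Rightarrow> 'a set \<Rightarrow> 'a set set \<Rightarrow> bool" where
  "primary_decomposition R J \<Q> \<longleftrightarrow>
     finite \<Q> \<and> (\<forall>Q \<in> \<Q>. primary_ideal R Q) \<and> carrier R \<inter> \<Inter>\<Q> = J \<and>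
     inj_on (radical R) \<Q> \<and> (\<forall>Q \<in> \<Q>. carrier R \<inter> \<Inter>(\<Q> - {Q}) \<noteq> J)"

text \<open>The components belonging to minimal primes of \<open>J\<close> do not depend on the decomposition,
  so collecting them over all decompositions gives the same set as using any single one.\<close>

definition unmixed_part :: "('a, 'b) ring_scheme \<Rightarrow> 'a set \<Rightarrow> 'a set" where
  "unmixed_part R J = carrier R \<inter>
     \<Inter>{Q. \<exists>\<Q>. primary_decomposition R J \<Q> \<and> Q \<in> \<Q> \<and> radical R Q \<in> min_primes R J}"

definition unmixed_ideal :: "('a, 'b) ring_scheme \<Rightarrow> 'a set \<Rightarrow> bool" where
  "unmixed_ideal R J \<longleftrightarrow> ideal J R \<and> unmixed_part R J = J"


section \<open>Localization\<close>

definition fraction :: "('a, 'b) ring_scheme \<Rightarrow> 'a set \<Rightarrow> 'a \<Rightarrow> 'a \<Rightarrow> ('a \<times> 'a) set" where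
  "fraction R S a s = {(b, t). b \<in> carrier R \<and> t \<in> S \<and>
     (\<exists>u \<in> S. u \<otimes>\<^bsub>R\<^esub> (a \<otimes>\<^bsub>R\<^esub> t) = u \<otimes>\<^bsub>R\<^esub> (b \<otimes>\<^bsub>R\<^esub> s))}"

text \<open>As in \<^const>\<open>rcoset_mult\<close>, the operations on classes are unions over all
  representatives; all members of such a union coincide.\<close>

definition localization :: "('a, 'b) ring_scheme \<Rightarrow> 'a set \<Rightarrow> ('a \<times> 'a) set ring" where
  "localization R S =
    \<lparr>carrier = {fraction R S a s | a s. a \<in> carrier R \<and> s \<in> S},
     monoid.mult = (\<lambda>X Y. \<Union>(a, s) \<in> X. \<Union>(b, t) \<in> Y. fraction R S (a \<otimes>\<^bsub>R\<^esub> b) (s \<otimes>\<^bsub>R\<^esub> t)),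
     one = fraction R S \<one>\<^bsub>R\<^esub> \<one>\<^bsub>R\<^esub>,
     ring.zero = fraction R S \<zero>\<^bsub>R\<^esub> \<one>\<^bsub>R\<^esub>,
     add = (\<lambda>X Y. \<Union>(a, s) \<in> X. \<Union>(b, t) \<in> Y.
              fraction R S ((a \<otimes>\<^bsub>R\<^esub> t) \<oplus>\<^bsub>R\<^esub> (b \<otimes>\<^bsub>R\<^esub> s)) (s \<otimes>\<^bsub>R\<^esub> t))\<rparr>"

definition loc_at :: "('a, 'b) ring_scheme \<Rightarrow> 'a set \<Rightarrow> ('a \<times> 'a) set ring" where
  "loc_at R p = localization R (carrier R - p)"

definition loc_ideal :: "('a, 'b) ring_scheme \<Rightarrow> 'a set \<Rightarrow> 'a set \<Rightarrow> ('a \<times> 'a) set set" where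
  "loc_ideal R p I =
     Idl\<^bsub>loc_at R p\<^esub> ((\<lambda>a. fraction R (carrier R - p) a \<one>\<^bsub>R\<^esub>) ` I)"


section \<open>Length and Hilbert coefficients\<close>

definition module_length :: "('a, 'b) ring_scheme \<Rightarrow> ('a, 'c, 'd) module_scheme \<Rightarrow> enat" where
  "module_length R M = Sup {enat n | n. \<exists>N. (\<forall>i\<le>n. submodule (N i) R M) \<and>
     (\<forall>i<n. N i \<subset> N (Suc i))}"

definition quot_module :: "('a, 'b) ring_scheme \<Rightarrow> 'a set \<Rightarrow> ('a, 'a set) module" where
  "quot_module R I =
    \<lparr>carrier = carrier (R Quot I), monoid.mult = monoid.mult (R Quot I), one = one (R Quot I),
     ring.zero = ring.zero (R Quot I), add = add (R Quot I),
     smult = (\<lambda>a X. (I +>\<^bsub>R\<^esub> a) \<otimes>\<^bsub>R Quot I\<^esub> X)\<rparr>"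

definition hilbert_coeffs :: "('a, 'b) ring_scheme \<Rightarrow> 'a set \<Rightarrow> (nat \<Rightarrow> int) \<Rightarrow> bool" where
  "hilbert_coeffs A Q e \<longleftrightarrow> (\<exists>s. krull_dim A = enat s \<and>
     (\<forall>\<^sub>F n in sequentially. \<exists>l. module_length A (quot_module A (ideal_pow A Q n)) = enat l \<and>
        int l = (\<Sum>i\<le>s. (- 1) ^ i * e i * int ((n + s - i - 1) choose (s - i)))))"

text \<open>Only meaningful for \<open>Q\<close> primary to the maximal ideal of a Noetherian local ring \<open>A\<close> and
  \<open>i \<le> dim A\<close>; in that range the coefficient exists and is unique.\<close>

definition hilbert_coeff :: "('a, 'b) ring_scheme \<Rightarrow> 'a set \<Rightarrow> nat \<Rightarrow> int" where
  "hilbert_coeff A Q i = (THE c. \<exists>e. hilbert_coeffs A Q e \<and> e i = c)"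


section \<open>Equimultiple coefficient ideals\<close>

definition coeff_extensions :: "('a, 'b) ring_scheme \<Rightarrow> 'a set \<Rightarrow> nat \<Rightarrow> 'a set set" where
  "coeff_extensions R I k = {L. ideal L R \<and> I \<subseteq> L \<and>
     (\<forall>p \<in> min_primes R I.
        loc_ideal R p L \<noteq> carrier (loc_at R p) \<and>
        (\<forall>i\<le>k. hilbert_coeff (loc_at R p) (loc_ideal R p I) i =
                hilbert_coeff (loc_at R p) (loc_ideal R p L) i))}"

text \<open>\<open>L\<close> is the \<open>k\<close>-th coefficient ideal of \<open>I\<close>; such an \<open>L\<close> is unique.\<close>

definition is_coeff_ideal :: "('a, 'b) ring_scheme \<Rightarrow> 'a set \<Rightarrow> nat \<Rightarrow> 'a set \<Rightarrow> bool" where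
  "is_coeff_ideal R I k L \<longleftrightarrow>
     L \<in> coeff_extensions R I k \<and> (\<forall>L' \<in> coeff_extensions R I k. L' \<subseteq> L)"

lemma is_coeff_ideal_unique:
  "is_coeff_ideal R I k L \<Longrightarrow> is_coeff_ideal R I k L' \<Longrightarrow> L = L'"
  unfolding is_coeff_ideal_def by blast

end

theory Submission
  imports Defs
begin

text \<open>By Lasker--Noether, the unmixed part of \<open>J\<close> is the intersection of the preimages of the
  localizations \<open>J R_p\<close> over the minimal primes \<open>p\<close> of \<open>J\<close>; hence passing to the unmixed part
  changes neither the minimal primes nor the localizations at them. Since the defining condition
  of coefficient ideals only sees \<open>L_p\<close> at those primes, whatever the Hilbert coefficients are,
  \<open>L\<^sup>u\<close> is an admissible extension of \<open>I\<close> whenever \<open>L\<close> is. Maximality of the coefficient ideal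
  \<open>L\<close> gives \<open>L\<^sup>u = L\<close>, so \<open>I\<^sup>u \<subseteq> L\<close>; and the admissible extensions of \<open>I\<^sup>u\<close> are those of
  \<open>I\<close> that contain \<open>I\<^sup>u\<close>.\<close>

section \<open>Primary decomposition\<close>

locale noetherian_cring = cring R + noetherian_ring R for R (structure)

section \<open>Maximal elements in families of ideals\<close>

context noetherian_ring
begin

text \<open>In a Noetherian ring a nonempty chain of ideals contains its own union, so Zorn's lemma
  applies without any assumption that \<open>P\<close> passes to unions. This is the form in which
  the chain condition enters primary decomposition.\<close>

lemma ex_maximal_ideal_with:
  assumes "ideal J R" "P J"
  obtains M where "ideal M R" "P M" "\<And>K. ideal K R \<Longrightarrow> P K \<Longrightarrow> M \<subseteq> K \<Longrightarrow> K = M"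
proof -
  let ?S = "{K. ideal K R \<and> P K}"
  have "\<exists>M\<in>?S. \<forall>K\<in>?S. M \<subseteq> K \<longrightarrow> K = M"
  proof (rule subset_Zorn)
    fix C assume C: "subset.chain ?S C"
    show "\<exists>U\<in>?S. \<forall>K\<in>C. K \<subseteq> U"
    proof (cases "C = {}")
      case True
      then show ?thesis using assms by auto
    next
      case False
      have "subset.chain {K. ideal K R} C"
        using C unfolding pred_on.chain_def by auto
      from ideal_chain_is_trivial[OF False this] have "\<Union>C \<in> C" .
      moreover have "C \<subseteq> ?S" using C unfolding pred_on.chain_def by auto
      ultimately have "\<Union>C \<in> ?S" by (rule subsetD[rotated])
      then show ?thesis by (rule bexI[rotated]) auto
    qed
  qed
  then show ?thesis using that by auto
qed

end

section \<open>Colon ideals, radicals and primary ideals\<close>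

context cring
begin

lemma ideal_subsetD: "ideal J R \<Longrightarrow> J \<subseteq> carrier R"
  by (rule subsetI) (rule ideal.Icarr)

text \<open>Supplies the ideals \<open>J : b^n\<close> for Noether's argument in
  \<open>irreducible_imp_primary\<close>.\<close>

lemma colon_ideal:
  assumes J: "ideal J R" and b: "b \<in> carrier R"
  shows "ideal {x \<in> carrier R. b \<otimes> x \<in> J} R"
proof (intro idealI subgroup.intro)
  interpret J: ideal J R by fact
  show "ring R" by (rule ring_axioms)
  show "{x \<in> carrier R. b \<otimes> x \<in> J} \<subseteq> carrier (add_monoid R)" by auto
  fix x y
  assume x: "x \<in> {x \<in> carrier R. b \<otimes> x \<in> J}" 
  { assume y: "y \<in> {x \<in> carrier R. b \<otimes> x \<in> J}"
    show "x \<otimes>\<^bsub>add_monoid R\<^esub> y \<in> {x \<in> carrier R. b \<otimes> x \<in> J}"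
      using x y b by (auto simp: r_distr) }
  have "b \<otimes> (\<ominus> x) = \<ominus> (b \<otimes> x)" using x b by (simp add: r_minus)
  then have "\<ominus> x \<in> {x \<in> carrier R. b \<otimes> x \<in> J}" using x by auto
  then show "inv\<^bsub>add_monoid R\<^esub> x \<in> {x \<in> carrier R. b \<otimes> x \<in> J}" by (simp add: a_inv_def)
  { assume y: "y \<in> carrier R"
    have "b \<otimes> (y \<otimes> x) = y \<otimes> (b \<otimes> x)" using x y b by (simp add: m_ac)
    then show "y \<otimes> x \<in> {x \<in> carrier R. b \<otimes> x \<in> J}"
      using x y J.I_l_closed by auto
    then show "x \<otimes> y \<in> {x \<in> carrier R. b \<otimes> x \<in> J}"
      using x y by (simp add: m_comm) }
next
  show "\<one>\<^bsub>add_monoid R\<^esub> \<in> {x \<in> carrier R. b \<otimes> x \<in> J}"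
    using b J by (simp add: additive_subgroup.zero_closed ideal.axioms(1))
qed

lemma subset_radical: "ideal J R \<Longrightarrow> J \<subseteq> radical R J"
proof
  fix x assume "ideal J R" "x \<in> J"
  then have "x \<in> carrier R" "x [^] (1::nat) \<in> J" by (auto simp: ideal.Icarr)
  then show "x \<in> radical R J" unfolding radical_def by blast
qed

lemma radical_radical: "radical R (radical R J) = radical R J"
proof
  show "radical R (radical R J) \<subseteq> radical R J"
    unfolding radical_def by (auto simp: nat_pow_pow)
  show "radical R J \<subseteq> radical R (radical R J)"
  proof
    fix x assume x: "x \<in> radical R J"
    then have "x \<in> carrier R" "x [^] (1::nat) \<in> radical R J" unfolding radical_def by simp_all
    then show "x \<in> radical R (radical R J)" unfolding radical_def[of R "radical R J"] by blast
  qed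
qed

lemma pow_mem_mono:
  assumes "ideal J R" "x \<in> carrier R" "x [^] (n::nat) \<in> J" "n \<le> k"
  shows "x [^] k \<in> J"
proof -
  have "x [^] k = x [^] (k - n) \<otimes> x [^] n"
    using assms by (simp add: nat_pow_mult)
  then show ?thesis using assms by (simp add: ideal.I_l_closed)
qed

lemma radical_Int:
  assumes "ideal J R" "ideal K R"
  shows "radical R (J \<inter> K) = radical R J \<inter> radical R K"
proof
  show "radical R J \<inter> radical R K \<subseteq> radical R (J \<inter> K)"
  proof
    fix x assume "x \<in> radical R J \<inter> radical R K"
    then obtain i j :: nat where x: "x \<in> carrier R" and ij: "x [^] i \<in> J" "x [^] j \<in> K"
      unfolding radical_def by auto
    have "x [^] max i j \<in> J \<inter> K"
      using pow_mem_mono[OF assms(1) x ij(1)] pow_mem_mono[OF assms(2) x ij(2)] by auto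
    then show "x \<in> radical R (J \<inter> K)" using x unfolding radical_def by blast
  qed
qed (auto simp: radical_def)

lemma mem_prime_of_pow:
  assumes "primeideal p R" "x \<in> carrier R" "x [^] (n::nat) \<in> p"
  shows "x \<in> p"
  using assms(3)
proof (induction n)
  case 0
  interpret primeideal p R by fact
  show ?case using 0 one_imp_carrier I_notcarr by auto
next
  case (Suc n)
  then show ?case using primeideal.I_prime[OF assms(1) _ assms(2), of "x [^] n"] assms(2) by auto
qed

lemma radical_subset_prime:
  assumes "primeideal p R" "J \<subseteq> p"
  shows "radical R J \<subseteq> p"
  using assms mem_prime_of_pow[OF assms(1)] unfolding radical_def by blast

lemma primary_idealD:
  assumes "primary_ideal R Q"
  shows "ideal Q R" "Q \<noteq> carrier R"
    "\<And>a b. a \<in> carrier R \<Longrightarrow> b \<in> carrier R \<Longrightarrow> a \<otimes> b \<in> Q \<Longrightarrow> a \<in> Q \<or> b \<in> radical R Q"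
  using assms unfolding primary_ideal_def by blast+

lemma radical_ideal:
  assumes J: "ideal J R"
  shows "ideal (radical R J) R"
proof -
  interpret J: ideal J R by fact
  have add: "x \<oplus> y \<in> radical R J" if "x \<in> radical R J" "y \<in> radical R J" for x y
  proof -
    from that obtain i j :: nat where x: "x \<in> carrier R" "x [^] i \<in> J" 
      and y: "y \<in> carrier R" "y [^] j \<in> J"
      unfolding radical_def by auto
    \<comment> \<open>This replaces the binomial theorem. Splitting off one factor
      \<open>x \<oplus> y\<close> raises \<open>a\<close> or \<open>b\<close> by one and keeps the
      total degree; once \<open>n = 0\<close>, the degree bound forces \<open>i \<le> a\<close> or
      \<open>j \<le> b\<close>.\<close>
    have gen: "x [^] (a::nat) \<otimes> y [^] (b::nat) \<otimes> (x \<oplus> y) [^] n \<in> J" if "i + j \<le> a + b + n" for a b n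
      using that
    proof (induction n arbitrary: a b)
      case 0
      then consider "i \<le> a" | "j \<le> b" by linarith
      then show ?case
      proof cases
        case 1
        then show ?thesis using pow_mem_mono[OF J x] x y by (simp add: J.I_r_closed)
      next
        case 2
        then show ?thesis using pow_mem_mono[OF J y] x y by (simp add: J.I_l_closed)
      qed
    next
      case (Suc n)
      have "x [^] a \<otimes> y [^] b \<otimes> (x \<oplus> y) [^] Suc n
          = x [^] Suc a \<otimes> y [^] b \<otimes> (x \<oplus> y) [^] n \<oplus> x [^] a \<otimes> y [^] Suc b \<otimes> (x \<oplus> y) [^] n"
        using x y by (simp add: l_distr r_distr m_ac)
      also have "\<dots> \<in> J" using Suc.IH[of "Suc a" b] Suc.IH[of a "Suc b"] Suc.prems by auto
      finally show ?case .
    qed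
    from gen[of 0 0 "i + j"] have "(x \<oplus> y) [^] (i + j) \<in> J" using x y by simp
    then show ?thesis unfolding radical_def using x y by auto
  qed
  have mult: "y \<otimes> x \<in> radical R J" if "x \<in> radical R J" "y \<in> carrier R" for x y
    using that unfolding radical_def
    by (auto simp: nat_pow_distrib intro!: J.I_l_closed)
  show ?thesis
  proof (intro idealI subgroup.intro)
    show "ring R" by (rule ring_axioms)
    show "radical R J \<subseteq> carrier (add_monoid R)" unfolding radical_def by auto
    show "\<one>\<^bsub>add_monoid R\<^esub> \<in> radical R J"
      using subset_radical[OF J] J.zero_closed by auto
    fix x y assume x: "x \<in> radical R J"
    then have xc: "x \<in> carrier R" unfolding radical_def by auto
    show "y \<in> radical R J \<Longrightarrow> x \<otimes>\<^bsub>add_monoid R\<^esub> y \<in> radical R J" using add x by auto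
    show *: "y \<in> carrier R \<Longrightarrow> y \<otimes> x \<in> radical R J" using mult x by auto
    show "y \<in> carrier R \<Longrightarrow> x \<otimes> y \<in> radical R J" using * xc by (simp add: m_comm)
    have "(\<ominus> \<one>) \<otimes> x \<in> radical R J" using mult x by auto
    moreover have "(\<ominus> \<one>) \<otimes> x = \<ominus> x" using xc by (simp add: l_minus)
    ultimately show "inv\<^bsub>add_monoid R\<^esub> x \<in> radical R J" by (simp add: a_inv_def)
  qed
qed

text \<open>The primary condition is applied to \<open>a [^] n\<close> and \<open>b [^] n\<close>;
  the second alternative then lands in the radical of the radical, which is the radical
  again.\<close>

lemma radical_primary_prime:
  assumes Q: "primary_ideal R Q"
  shows "primeideal (radical R Q) R"
proof (rule primeidealI)
  note Q' = primary_idealD[OF Q]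
  show "ideal (radical R Q) R" using radical_ideal Q' by blast
  show "cring R" by (rule is_cring)
  show "carrier R \<noteq> radical R Q"
  proof
    assume "carrier R = radical R Q"
    then have "\<one> \<in> radical R Q" by auto
    then have "\<one> \<in> Q" unfolding radical_def by auto
    then show False using Q' ideal.one_imp_carrier by blast
  qed
  fix a b assume ab: "a \<in> carrier R" "b \<in> carrier R" "a \<otimes> b \<in> radical R Q"
  then obtain n :: nat where "a [^] n \<otimes> b [^] n \<in> Q"
    unfolding radical_def by (auto simp: nat_pow_distrib)
  then have "a [^] n \<in> Q \<or> b [^] n \<in> radical R Q" using Q'(3) ab by auto
  then have "a \<in> radical R Q \<or> b \<in> radical R (radical R Q)"
    using ab unfolding radical_def by auto
  then show "a \<in> radical R Q \<or> b \<in> radical R Q" by (simp add: radical_radical)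
qed

text \<open>Used to merge two components with the same radical. That radical is also the radical of
  the intersection, so a second factor outside it forces the first factor into both ideals.\<close>

lemma primary_Int:
  assumes Q: "primary_ideal R Q" "primary_ideal R Q'" and eq: "radical R Q = radical R Q'"
  shows "primary_ideal R (Q \<inter> Q')"
proof -
  note 1 = primary_idealD[OF Q(1)] and 2 = primary_idealD[OF Q(2)]
  have "radical R (Q \<inter> Q') = radical R Q" using radical_Int[OF 1(1) 2(1)] eq by auto
  moreover have "Q \<inter> Q' \<noteq> carrier R" using 1(1,2) ideal_subsetD[OF 1(1)] by auto
  ultimately show ?thesis unfolding primary_ideal_def
    using i_intersect[OF 1(1) 2(1)] 1(3) 2(3) eq by (metis Int_iff)
qed

end

section \<open>Existence of primary decompositions (Lasker-Noether)\<close>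

context noetherian_cring
begin

text \<open>Noether's argument: once the chain of colon ideals \<open>J : b^n\<close> is stationary,
  \<open>J\<close> is the intersection of \<open>J + (a)\<close> and \<open>J + (b^n)\<close>.
  Irreducibility then puts \<open>a\<close> or \<open>b^n\<close> into \<open>J\<close>.\<close>

lemma irreducible_imp_primary:
  assumes J: "ideal J R" "J \<noteq> carrier R"
    and irred: "\<And>A B. ideal A R \<Longrightarrow> ideal B R \<Longrightarrow> A \<inter> B = J \<Longrightarrow> A = J \<or> B = J"
  shows "primary_ideal R J"
  unfolding primary_ideal_def
proof (intro conjI ballI impI J)
  interpret J: ideal J R by fact
  fix a b assume a: "a \<in> carrier R" and b: "b \<in> carrier R" and ab: "a \<otimes> b \<in> J"
  define N where "N n = {x \<in> carrier R. b [^] n \<otimes> x \<in> J}" for n :: nat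
  have N: "ideal (N n) R" for n unfolding N_def using colon_ideal[OF J(1)] b by auto
  \<comment> \<open>A maximal member of the family marks the place where the chain of colon ideals
    stops growing.\<close>
  obtain M where "M \<in> range N"
    and M: "\<And>K. ideal K R \<Longrightarrow> K \<in> range N \<Longrightarrow> M \<subseteq> K \<Longrightarrow> K = M"
    using ex_maximal_ideal_with[of "N 0" "\<lambda>K. K \<in> range N", OF N] by (metis rangeI)
  then obtain n where "M = N n" by auto
  then have n: "N k = N n" if "N n \<subseteq> N k" for k using M[OF N] that by auto
  have "N n \<subseteq> N (Suc n)"
  proof
    fix x assume x: "x \<in> N n"
    then have "b [^] Suc n \<otimes> x = b \<otimes> (b [^] n \<otimes> x)" using b unfolding N_def by (simp add: m_ac)
    then show "x \<in> N (Suc n)" using x b unfolding N_def by (simp add: J.I_l_closed del: nat_pow_Suc)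
  qed
  from n[OF this] have stable: "N (Suc n) = N n" .
  define A :: "'a set" where "A = J <+> PIdl a"
  define B :: "'a set" where "B = J <+> PIdl (b [^] n)"
  have ideals: "ideal A R" "ideal B R"
    unfolding A_def B_def
    using a b add_ideals[OF J(1) cgenideal_ideal] by auto
  have sub: "J \<subseteq> J <+> PIdl c" "c \<in> J <+> PIdl c" if c: "c \<in> carrier R" for c
  proof -
    interpret P: ideal "PIdl c" R by (rule cgenideal_ideal[OF c])
    have "c = \<zero> \<oplus> c" using c by simp
    then show "c \<in> J <+> PIdl c"
      unfolding set_add_def' using J.zero_closed cgenideal_self[OF c] by blast
    show "J \<subseteq> J <+> PIdl c"
    proof
      fix x assume "x \<in> J"
      then have "x = x \<oplus> \<zero>" by (simp add: J.Icarr)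
      then show "x \<in> J <+> PIdl c" unfolding set_add_def' using \<open>x \<in> J\<close> P.zero_closed by blast
    qed
  qed
  have "A \<inter> B = J"
  proof
    show "J \<subseteq> A \<inter> B" using sub a b unfolding A_def B_def by auto
    show "A \<inter> B \<subseteq> J"
    proof
      fix y assume "y \<in> A \<inter> B"
      then have "y \<in> A" "y \<in> B" by auto
      obtain q r where y1: "y = q \<oplus> r \<otimes> a" and q: "q \<in> J" "r \<in> carrier R"
        using \<open>y \<in> A\<close> unfolding A_def set_add_def' cgenideal_def by blast
      obtain q' r' where y2: "y = q' \<oplus> r' \<otimes> b [^] n" and q': "q' \<in> J" "r' \<in> carrier R"
        using \<open>y \<in> B\<close> unfolding B_def set_add_def' cgenideal_def by blast
      note qc = J.Icarr[OF q(1)] J.Icarr[OF q'(1)]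
      \<comment> \<open>Multiplying the first expression for \<open>y\<close> by \<open>b\<close>
        gives an element of \<open>J\<close>, because \<open>a \<otimes> b \<in> J\<close>. The
        second expression then shows that \<open>r'\<close> lies in \<open>N (Suc n) = N n\<close>,
        so its summand \<open>r' \<otimes> b [^] n\<close> is in \<open>J\<close>, and so is
        \<open>y\<close>.\<close>
      have "b \<otimes> y = b \<otimes> q \<oplus> r \<otimes> (a \<otimes> b)" unfolding y1 using qc q a b by (simp add: r_distr m_ac)
      then have "b \<otimes> y \<in> J" using q ab b by (simp add: J.I_l_closed)
      moreover have "b \<otimes> y = b \<otimes> q' \<oplus> b [^] Suc n \<otimes> r'"
        unfolding y2 using qc q' b by (simp add: r_distr m_ac)
      then have "b [^] Suc n \<otimes> r' = \<ominus> (b \<otimes> q') \<oplus> b \<otimes> y"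
        using qc q' b by (simp add: r_neg1 del: nat_pow_Suc)
      ultimately have "b [^] Suc n \<otimes> r' \<in> J"
        using q' b by (simp add: J.I_l_closed del: nat_pow_Suc)
      then have "r' \<in> N n" using q' stable unfolding N_def by blast
      then show "y \<in> J" unfolding y2 using q' b unfolding N_def by (simp add: m_comm)
    qed
  qed
  have "a \<in> A" "b [^] n \<in> B" unfolding A_def B_def using sub(2) a b by auto
  moreover from irred[OF ideals \<open>A \<inter> B = J\<close>] have "A = J \<or> B = J" .
  ultimately show "a \<in> J \<or> b \<in> radical R J" using b unfolding radical_def by auto
qed

text \<open>Noetherian induction: a maximal counterexample is proper and not primary, hence the
  intersection of two strictly larger ideals. These have finite primary families, whose union serves
  for the counterexample.\<close>

lemma ex_primary_Inter:
  assumes "ideal J R"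
  shows "\<exists>\<Q>. finite \<Q> \<and> (\<forall>Q\<in>\<Q>. primary_ideal R Q) \<and> carrier R \<inter> \<Inter>\<Q> = J"
proof (rule ccontr)
  define D where "D K \<longleftrightarrow> (\<exists>\<Q>. finite \<Q> \<and> (\<forall>Q\<in>\<Q>. primary_ideal R Q) \<and> carrier R \<inter> \<Inter>\<Q> = K)" for K
  assume "\<nexists>\<Q>. finite \<Q> \<and> (\<forall>Q\<in>\<Q>. primary_ideal R Q) \<and> carrier R \<inter> \<Inter>\<Q> = J"
  then have "\<not> D J" unfolding D_def .
  obtain M where M: "ideal M R" "\<not> D M"
    and max: "\<And>K. ideal K R \<Longrightarrow> \<not> D K \<Longrightarrow> M \<subseteq> K \<Longrightarrow> K = M"
    using ex_maximal_ideal_with[of J "\<lambda>K. \<not> D K", OF assms \<open>\<not> D J\<close>] by metis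
  have "M \<noteq> carrier R"
  proof
    assume "M = carrier R"
    \<comment> \<open>The factor \<open>carrier R\<close> in \<open>D\<close> makes the empty family
      represent the unit ideal.\<close>
    then have "D M" unfolding D_def by (intro exI[of _ "{}"]) auto
    with M show False by blast
  qed
  moreover have "\<not> primary_ideal R M"
  proof
    assume "primary_ideal R M"
    then have "D M" using ideal_subsetD[OF M(1)] unfolding D_def by (intro exI[of _ "{M}"]) auto
    with M show False by blast
  qed
  ultimately obtain A B where AB: "ideal A R" "ideal B R" "A \<inter> B = M" "A \<noteq> M" "B \<noteq> M"
    using irreducible_imp_primary[OF M(1)] by blast
  have "D A" using max[OF AB(1)] AB(3,4) by auto
  moreover have "D B" using max[OF AB(2)] AB(3,5) by auto
  ultimately obtain \<A> \<B> where \<A>: "finite \<A>" "\<forall>Q\<in>\<A>. primary_ideal R Q" "carrier R \<inter> \<Inter>\<A> = A"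
    and \<B>: "finite \<B>" "\<forall>Q\<in>\<B>. primary_ideal R Q" "carrier R \<inter> \<Inter>\<B> = B" unfolding D_def by blast
  have "D M" using \<A> \<B> AB(3) unfolding D_def by (intro exI[of _ "\<A> \<union> \<B>"]) auto
  with M show False by blast
qed

text \<open>A family of primary ideals of least cardinality is irredundant, and two members with the
  same radical could be replaced by their intersection.\<close>

theorem ex_primary_decomposition:
  assumes "ideal J R"
  shows "\<exists>\<Q>. primary_decomposition R J \<Q>"
proof -
  define D where "D \<Q> \<longleftrightarrow> finite \<Q> \<and> (\<forall>Q\<in>\<Q>. primary_ideal R Q) \<and> carrier R \<inter> \<Inter>\<Q> = J" for \<Q>
  have "\<exists>\<Q>. D \<Q>" using ex_primary_Inter[OF assms] unfolding D_def .
  then obtain \<Q> where \<Q>: "D \<Q>" and least: "\<And>\<Q>'. D \<Q>' \<Longrightarrow> card \<Q> \<le> card \<Q>'"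
    using ex_has_least_nat[of D _ card] by metis
  note \<Q> = \<Q>[unfolded D_def]
  have "inj_on (radical R) \<Q>"
  proof (rule inj_onI, rule ccontr)
    fix P Q assume PQ: "P \<in> \<Q>" "Q \<in> \<Q>" "radical R P = radical R Q" "P \<noteq> Q"
    let ?\<Q>' = "insert (P \<inter> Q) (\<Q> - {P, Q})"
    have "D ?\<Q>'" using \<Q> PQ primary_Int[of P Q] unfolding D_def by auto
    then have "card \<Q> \<le> card ?\<Q>'" by (rule least)
    \<comment> \<open>Only an upper bound, since \<open>P \<inter> Q\<close> may already occur among
      the remaining members.\<close>
    moreover have "card ?\<Q>' \<le> Suc (card (\<Q> - {P, Q}))" using \<Q> by (simp add: card_insert_if)
    moreover have "card (\<Q> - {P, Q}) = card \<Q> - 2" using PQ \<Q> by (simp add: card_Diff_subset)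
    moreover have "2 \<le> card \<Q>" using card_mono[of \<Q> "{P, Q}"] PQ \<Q> by simp
    ultimately show False by linarith
  qed
  moreover have "carrier R \<inter> \<Inter>(\<Q> - {Q}) \<noteq> J" if "Q \<in> \<Q>" for Q
  proof
    assume "carrier R \<inter> \<Inter>(\<Q> - {Q}) = J"
    then have "card \<Q> \<le> card (\<Q> - {Q})" using \<Q> by (intro least) (auto simp: D_def)
    then show False using that \<Q> card_Diff1_less[of \<Q> Q] by linarith
  qed
  ultimately show ?thesis unfolding primary_decomposition_def using \<Q> by blast
qed

end

section \<open>Minimal primes and the unmixed part\<close>

context cring
begin

lemma prime_complement_closed:
  assumes "primeideal p R"
  shows "\<one> \<in> carrier R - p" "\<And>x y. x \<in> carrier R - p \<Longrightarrow> y \<in> carrier R - p \<Longrightarrow> x \<otimes> y \<in> carrier R - p"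
proof -
  interpret primeideal p R by fact
  show "\<one> \<in> carrier R - p" using one_imp_carrier I_notcarr by auto
  show "\<And>x y. x \<in> carrier R - p \<Longrightarrow> y \<in> carrier R - p \<Longrightarrow> x \<otimes> y \<in> carrier R - p"
    using I_prime by auto
qed

text \<open>The product of the individual multipliers works for all members at once and stays
  outside \<open>p\<close> because \<open>p\<close> is prime. The case \<open>x = \<one>\<close>
  yields \<open>Inter_subset_prime\<close>; general \<open>x\<close> is needed for
  \<open>unmixed_part_eq\<close>.\<close>

lemma ex_common_multiplier:
  assumes p: "primeideal p R" and "finite \<Q>" and "\<And>Q. Q \<in> \<Q> \<Longrightarrow> ideal Q R"
    and "\<And>Q. Q \<in> \<Q> \<Longrightarrow> \<exists>s\<in>carrier R - p. s \<otimes> x \<in> Q" and x: "x \<in> carrier R"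
  shows "\<exists>s\<in>carrier R - p. \<forall>Q\<in>\<Q>. s \<otimes> x \<in> Q"
  using assms(2-4)
proof (induction \<Q> rule: finite_induct)
  case empty
  then show ?case using prime_complement_closed(1)[OF p] by auto
next
  case (insert Q \<Q>)
  then obtain s t where s: "s \<in> carrier R - p" "\<forall>Q\<in>\<Q>. s \<otimes> x \<in> Q"
    and t: "t \<in> carrier R - p" "t \<otimes> x \<in> Q" by (metis insert_iff)
  have "s \<otimes> t \<in> carrier R - p" using prime_complement_closed(2)[OF p] s t by auto
  moreover have "s \<otimes> t \<otimes> x \<in> Q"
    using s t insert.prems(1)[of Q] x by (simp add: m_assoc ideal.I_l_closed)
  moreover have "s \<otimes> t \<otimes> x \<in> Q'" if "Q' \<in> \<Q>" for Q'
  proof -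
    have "s \<otimes> t \<otimes> x = t \<otimes> (s \<otimes> x)" using s t x by (simp add: m_ac)
    then show ?thesis using s t insert.prems(1)[of Q'] that by (simp add: ideal.I_l_closed)
  qed
  ultimately show ?case by auto
qed

text \<open>If every member had an element outside \<open>p\<close>, the common multiplier of
  \<open>\<one>\<close> would lie in the intersection but not in \<open>p\<close>.\<close>

lemma Inter_subset_prime:
  assumes p: "primeideal p R" and "finite \<Q>" "\<And>Q. Q \<in> \<Q> \<Longrightarrow> ideal Q R"
    and sub: "carrier R \<inter> \<Inter>\<Q> \<subseteq> p"
  obtains Q where "Q \<in> \<Q>" "Q \<subseteq> p"
proof (rule ccontr)
  assume "\<not> thesis"
  with that have no: "\<And>Q. Q \<in> \<Q> \<Longrightarrow> \<not> Q \<subseteq> p" by blast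
  have "\<exists>s\<in>carrier R - p. \<forall>Q\<in>\<Q>. s \<otimes> \<one> \<in> Q"
  proof (rule ex_common_multiplier[OF p assms(2,3)])
    fix Q assume Q: "Q \<in> \<Q>"
    then obtain s where "s \<in> Q" "s \<notin> p" using no by blast
    then show "\<exists>s\<in>carrier R - p. s \<otimes> \<one> \<in> Q" using ideal.Icarr[OF assms(3)[OF Q]] by force
  qed auto
  then show False using sub by auto
qed

end

section \<open>Minimal primes over an ideal\<close>

lemma min_primesD:
  assumes "p \<in> min_primes R J"
  shows "primeideal p R" "J \<subseteq> p" "\<And>q. primeideal q R \<Longrightarrow> J \<subseteq> q \<Longrightarrow> q \<subseteq> p \<Longrightarrow> q = p"
  using assms unfolding min_primes_def by auto

context noetherian_cring
begin

text \<open>The candidates are the finitely many radicals of the ideals in a primary representation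
  of \<open>J\<close>, so a minimal element of a finite set suffices.\<close>

lemma ex_min_prime_below:
  assumes J: "ideal J R" and q: "primeideal q R" "J \<subseteq> q"
  shows "\<exists>p\<in>min_primes R J. p \<subseteq> q"
proof -
  obtain \<Q> where fin: "finite \<Q>" and prim: "\<And>Q. Q \<in> \<Q> \<Longrightarrow> primary_ideal R Q"
    and inter: "carrier R \<inter> \<Inter>\<Q> = J"
    using ex_primary_Inter[OF J] by blast
  \<comment> \<open>Applied to \<open>q\<close>, this makes the set of candidates nonempty; applied
    to a competing prime inside \<open>P\<close>, it gives a candidate below that prime, which by
    minimality is \<open>P\<close>.\<close>
  have below: "\<exists>Q\<in>\<Q>. radical R Q \<subseteq> q'" if q': "primeideal q' R" "J \<subseteq> q'" for q'
  proof -
    obtain Q where "Q \<in> \<Q>" "Q \<subseteq> q'"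
      using Inter_subset_prime[OF q'(1) fin] prim primary_idealD(1) inter q'(2) by metis
    then show ?thesis using radical_subset_prime[OF q'(1)] by blast
  qed
  define S where "S = {P \<in> radical R ` \<Q>. P \<subseteq> q}"
  have "finite S" "S \<noteq> {}" unfolding S_def using fin below[OF q] by auto
  from finite_has_minimal[OF this] obtain P where P: "P \<in> S"
    and min: "\<And>P'. P' \<in> S \<Longrightarrow> P' \<subseteq> P \<Longrightarrow> P = P'" by metis
  from P obtain Q where Q: "Q \<in> \<Q>" "P = radical R Q" "P \<subseteq> q" unfolding S_def by auto
  have "J \<subseteq> Q" using Q inter by auto
  then have "J \<subseteq> P" using subset_radical primary_idealD(1)[OF prim] Q by blast
  moreover have "q' = P" if "primeideal q' R" "J \<subseteq> q'" "q' \<subseteq> P" for q'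
  proof -
    obtain Q' where "Q' \<in> \<Q>" "radical R Q' \<subseteq> q'" using below \<open>primeideal q' R\<close> \<open>J \<subseteq> q'\<close> by blast
    moreover from this have "P = radical R Q'" using \<open>q' \<subseteq> P\<close> Q(3) by (intro min) (auto simp: S_def)
    ultimately show ?thesis using \<open>q' \<subseteq> P\<close> by auto
  qed
  ultimately have "P \<in> min_primes R J"
    unfolding min_primes_def using radical_primary_prime[OF prim] Q by blast
  then show ?thesis using Q by blast
qed

text \<open>A prime minimal over \<open>K\<close> contains one minimal over \<open>J\<close>. The
  latter contains \<open>K\<close> by the last hypothesis, so the two agree.\<close>

lemma min_primes_eqI:
  assumes J: "ideal J R" and "J \<subseteq> K" and "\<And>p. p \<in> min_primes R J \<Longrightarrow> K \<subseteq> p"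
  shows "min_primes R K = min_primes R J"
proof
  show "min_primes R J \<subseteq> min_primes R K"
    using assms(2,3) unfolding min_primes_def by blast
  show "min_primes R K \<subseteq> min_primes R J"
  proof
    fix q assume q: "q \<in> min_primes R K"
    note q' = min_primesD[OF q]
    obtain p where p: "p \<in> min_primes R J" "p \<subseteq> q"
      using ex_min_prime_below[OF J q'(1)] q'(2) assms(2) by blast
    have "p = q" using q'(3)[OF min_primesD(1)[OF p(1)] assms(3)[OF p(1)] p(2)] .
    then show "q \<in> min_primes R J" using p by simp
  qed
qed

section \<open>Unmixed parts as intersections of contracted localizations\<close>

text \<open>For each \<open>p\<close> the inner condition says that \<open>x\<close> maps into the
  localization of \<open>J\<close> at \<open>p\<close>. This form no longer mentions decompositions
  and provides the denominators needed for localizing.\<close>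

theorem unmixed_part_eq:
  assumes J: "ideal J R"
  shows "unmixed_part R J =
    {x \<in> carrier R. \<forall>p\<in>min_primes R J. \<exists>s\<in>carrier R - p. s \<otimes> x \<in> J}" (is "_ = ?K")
proof
  show "?K \<subseteq> unmixed_part R J"
  proof
    fix x assume x: "x \<in> ?K"
    have "x \<in> Q" if Q_in: "primary_decomposition R J \<Q>" "Q \<in> \<Q>" "radical R Q \<in> min_primes R J" for Q \<Q>
    proof -
      have Q: "primary_ideal R Q" "J \<subseteq> Q"
        using Q_in(1,2) unfolding primary_decomposition_def by auto
      obtain s where s: "s \<in> carrier R - radical R Q" "s \<otimes> x \<in> Q"
        using x Q_in(3) Q(2) by blast
      \<comment> \<open>In \<open>primary_ideal\<close> the radical concerns the second factor, so
        \<open>s\<close> has to stand there to be cancelled.\<close>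
      then have "x \<otimes> s \<in> Q" using x by (simp add: m_comm)
      then show "x \<in> Q" using primary_idealD(3)[OF Q(1)] s x by blast
    qed
    then show "x \<in> unmixed_part R J" using x unfolding unmixed_part_def by blast
  qed
  show "unmixed_part R J \<subseteq> ?K"
  proof
    fix x assume x: "x \<in> unmixed_part R J"
    then have xc: "x \<in> carrier R" unfolding unmixed_part_def by blast
    obtain \<Q> where \<Q>: "primary_decomposition R J \<Q>" using ex_primary_decomposition[OF J] by blast
    then have fin: "finite \<Q>" and prim: "\<And>Q. Q \<in> \<Q> \<Longrightarrow> primary_ideal R Q"
      and inter: "carrier R \<inter> \<Inter>\<Q> = J" 
      unfolding primary_decomposition_def by auto
    have "\<exists>s\<in>carrier R - p. s \<otimes> x \<in> J" if p: "p \<in> min_primes R J" for p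
    proof -
      note p' = min_primesD[OF p]
      \<comment> \<open>A component inside \<open>p\<close> has radical \<open>p\<close> by
        minimality, so it already contains \<open>x\<close>. Any other component has an element
        outside \<open>p\<close>, which serves as multiplier.\<close>
      have "\<exists>s\<in>carrier R - p. s \<otimes> x \<in> Q" if Q: "Q \<in> \<Q>" for Q
      proof (cases "Q \<subseteq> p")
        case True
        have "J \<subseteq> radical R Q" using inter Q subset_radical[OF primary_idealD(1)[OF prim[OF Q]]] by blast
        then have "radical R Q = p"
          using p'(3)[OF radical_primary_prime[OF prim[OF Q]]] radical_subset_prime[OF p'(1) True] by blast
        then have "x \<in> Q" using x \<Q> Q p unfolding unmixed_part_def by blast
        then show ?thesis using xc by (intro bexI[OF _ prime_complement_closed(1)[OF p'(1)]]) simp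
      next
        case False
        then obtain s where "s \<in> Q" "s \<notin> p" by blast
        moreover have "ideal Q R" using primary_idealD(1)[OF prim[OF Q]] .
        ultimately have "s \<in> carrier R - p" "s \<otimes> x \<in> Q"
          using xc ideal.Icarr[of Q R s] ideal.I_r_closed[of Q R s x] by auto
        then show ?thesis by blast
      qed
      then obtain s where "s \<in> carrier R - p" "\<forall>Q\<in>\<Q>. s \<otimes> x \<in> Q"
        using ex_common_multiplier[OF p'(1) fin primary_idealD(1)[OF prim] _ xc] by metis
      then show ?thesis using inter xc by blast
    qed
    then show "x \<in> ?K" using xc by blast
  qed
qed

lemma subset_unmixed_part:
  assumes "ideal J R"
  shows "J \<subseteq> unmixed_part R J"
  using assms unfolding unmixed_part_def primary_decomposition_def
  by (auto simp: ideal.Icarr)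

lemma unmixed_part_subset_min_prime:
  assumes J: "ideal J R" and p: "p \<in> min_primes R J"
  shows "unmixed_part R J \<subseteq> p"
proof
  fix x assume "x \<in> unmixed_part R J"
  then obtain s where "x \<in> carrier R" "s \<in> carrier R - p" "s \<otimes> x \<in> J"
    unfolding unmixed_part_eq[OF J] using p by blast
  then show "x \<in> p" using primeideal.I_prime[OF min_primesD(1)[OF p], of s x] min_primesD(2)[OF p] by auto
qed

lemma min_primes_unmixed_part:
  assumes "ideal J R"
  shows "min_primes R (unmixed_part R J) = min_primes R J"
  using assms subset_unmixed_part unmixed_part_subset_min_prime by (intro min_primes_eqI) auto

text \<open>With equal minimal primes the same multipliers serve for both ideals. Otherwise the
  inclusion can fail: in a polynomial ring k[x,y], (x^2, xy) has unmixed part (x), while (x^2, xy,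
  y^2) is its own unmixed part.\<close>

lemma unmixed_part_mono:
  assumes "ideal J R" "ideal K R" "J \<subseteq> K" "min_primes R K = min_primes R J"
  shows "unmixed_part R J \<subseteq> unmixed_part R K"
  using assms(3,4) unfolding unmixed_part_eq[OF assms(1)] unmixed_part_eq[OF assms(2)] by blast

lemma unmixed_part_ideal:
  assumes J: "ideal J R"
  shows "ideal (unmixed_part R J) R"
proof -
  let ?S = "{Q. \<exists>\<Q>. primary_decomposition R J \<Q> \<and> Q \<in> \<Q> \<and> radical R Q \<in> min_primes R J}"
  \<comment> \<open>Inserting \<open>carrier R\<close> keeps the family nonempty, as
    \<open>i_Intersect\<close> requires, and reproduces the leading factor in
    \<open>unmixed_part\<close>.\<close>
  have "ideal (\<Inter>(insert (carrier R) ?S)) R"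
    by (rule i_Intersect) (auto simp: oneideal primary_decomposition_def primary_ideal_def)
  then show ?thesis unfolding unmixed_part_def by simp
qed

end

section \<open>Localization\<close>

locale cring_with_denominators = cring R for R (structure) +
  fixes S
  assumes S_carrier: "S \<subseteq> carrier R" and S_one: "\<one> \<in> S"
    and S_mult: "s \<in> S \<Longrightarrow> t \<in> S \<Longrightarrow> s \<otimes> t \<in> S"
begin

lemma S_closed [simp]: "s \<in> S \<Longrightarrow> s \<in> carrier R"
  using S_carrier by blast

abbreviation frac where "frac \<equiv> fraction R S"

text \<open>Transitivity of the fraction relation: with the multiplier
  \<open>u \<otimes> w \<otimes> s\<close>, the two given equations meet in a multiple of
  \<open>a \<otimes> t \<otimes> v\<close>.\<close>

lemma fraction_subset:
  assumes closed: "a \<in> carrier R" "s \<in> S" "b \<in> carrier R" "t \<in> S" "u \<in> S"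
    and eq: "u \<otimes> (a \<otimes> t) = u \<otimes> (b \<otimes> s)"
  shows "frac a s \<subseteq> frac b t"
proof (rule subrelI)
  fix c v assume "(c, v) \<in> frac a s"
  then obtain w where c: "c \<in> carrier R" "v \<in> S" "w \<in> S" and w: "w \<otimes> (a \<otimes> v) = w \<otimes> (c \<otimes> s)"
    unfolding fraction_def by auto
  have "(u \<otimes> w \<otimes> s) \<otimes> (b \<otimes> v) = w \<otimes> v \<otimes> (u \<otimes> (b \<otimes> s))" using closed c by (simp add: m_ac)
  also have "\<dots> = w \<otimes> v \<otimes> (u \<otimes> (a \<otimes> t))" by (simp add: eq)
  also have "\<dots> = u \<otimes> t \<otimes> (w \<otimes> (a \<otimes> v))" using closed c by (simp add: m_ac)
  also have "\<dots> = (u \<otimes> w \<otimes> s) \<otimes> (c \<otimes> t)" unfolding w using closed c by (simp add: m_ac)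
  finally show "(c, v) \<in> frac b t"
    unfolding fraction_def using c closed S_mult by blast
qed

lemma fraction_eqI:
  assumes "a \<in> carrier R" "s \<in> S" "b \<in> carrier R" "t \<in> S" "u \<in> S"
    and "u \<otimes> (a \<otimes> t) = u \<otimes> (b \<otimes> s)"
  shows "frac a s = frac b t"
  using fraction_subset[OF assms] fraction_subset[OF assms(3,4,1,2,5) assms(6)[symmetric]] by blast

lemma fraction_refl: "a \<in> carrier R \<Longrightarrow> s \<in> S \<Longrightarrow> (a, s) \<in> frac a s"
  unfolding fraction_def using S_one by auto

lemma fractionE:
  assumes "(b, t) \<in> frac a s"
  obtains u where "b \<in> carrier R" "t \<in> S" "u \<in> S" "u \<otimes> (a \<otimes> t) = u \<otimes> (b \<otimes> s)"
  using assms unfolding fraction_def by auto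

abbreviation L where "L \<equiv> localization R S"

text \<open>Multipliers for the two factors multiply to one for the product, so every set in the
  defining union is the same class. The union is over nonempty classes and therefore collapses to
  it.\<close>

lemma frac_mult:
  assumes "a \<in> carrier R" "s \<in> S" "b \<in> carrier R" "t \<in> S"
  shows "frac a s \<otimes>\<^bsub>L\<^esub> frac b t = frac (a \<otimes> b) (s \<otimes> t)"
proof -
  have *: "frac (a' \<otimes> b') (s' \<otimes> t') = frac (a \<otimes> b) (s \<otimes> t)"
    if mem: "(a', s') \<in> frac a s" "(b', t') \<in> frac b t" for a' s' b' t'
  proof -
    from mem obtain u v where c: "a' \<in> carrier R" "s' \<in> S" "u \<in> S" "b' \<in> carrier R" "t' \<in> S" "v \<in> S"
      and u: "u \<otimes> (a \<otimes> s') = u \<otimes> (a' \<otimes> s)" and v: "v \<otimes> (b \<otimes> t') = v \<otimes> (b' \<otimes> t)"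
      by (metis fractionE)
    have "(u \<otimes> v) \<otimes> (a' \<otimes> b' \<otimes> (s \<otimes> t)) = (u \<otimes> (a' \<otimes> s)) \<otimes> (v \<otimes> (b' \<otimes> t))"
      using assms c by (simp add: m_ac)
    also have "\<dots> = (u \<otimes> (a \<otimes> s')) \<otimes> (v \<otimes> (b \<otimes> t'))" by (simp add: u v)
    also have "\<dots> = (u \<otimes> v) \<otimes> (a \<otimes> b \<otimes> (s' \<otimes> t'))" using assms c by (simp add: m_ac)
    finally show ?thesis using assms c S_mult by (intro fraction_eqI[of _ _ _ _ "u \<otimes> v"]) auto
  qed
  have "frac a s \<otimes>\<^bsub>L\<^esub> frac b t = (\<Union>(a', s')\<in>frac a s. \<Union>(b', t')\<in>frac b t. frac (a' \<otimes> b') (s' \<otimes> t'))"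
    unfolding localization_def by simp
  also have "\<dots> = (\<Union>x\<in>frac a s. \<Union>y\<in>frac b t. frac (a \<otimes> b) (s \<otimes> t))"
    by (intro SUP_cong refl) (auto simp: *)
  also have "\<dots> = frac (a \<otimes> b) (s \<otimes> t)"
    using fraction_refl[OF assms(1,2)] fraction_refl[OF assms(3,4)] by auto
  finally show ?thesis .
qed

lemma frac_add:
  assumes "a \<in> carrier R" "s \<in> S" "b \<in> carrier R" "t \<in> S"
  shows "frac a s \<oplus>\<^bsub>L\<^esub> frac b t = frac (a \<otimes> t \<oplus> b \<otimes> s) (s \<otimes> t)"
proof -
  have *: "frac (a' \<otimes> t' \<oplus> b' \<otimes> s') (s' \<otimes> t') = frac (a \<otimes> t \<oplus> b \<otimes> s) (s \<otimes> t)"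
    if mem: "(a', s') \<in> frac a s" "(b', t') \<in> frac b t" for a' s' b' t'
  proof -
    from mem obtain u v where c: "a' \<in> carrier R" "s' \<in> S" "u \<in> S" "b' \<in> carrier R" "t' \<in> S" "v \<in> S"
      and u: "u \<otimes> (a \<otimes> s') = u \<otimes> (a' \<otimes> s)" and v: "v \<otimes> (b \<otimes> t') = v \<otimes> (b' \<otimes> t)"
      by (metis fractionE)
    \<comment> \<open>The expression splits into two summands, each a multiple of one of the
      equations \<open>u\<close> and \<open>v\<close>.\<close>
    have "(u \<otimes> v) \<otimes> ((a' \<otimes> t' \<oplus> b' \<otimes> s') \<otimes> (s \<otimes> t))
        = (v \<otimes> t' \<otimes> t) \<otimes> (u \<otimes> (a' \<otimes> s)) \<oplus> (u \<otimes> s' \<otimes> s) \<otimes> (v \<otimes> (b' \<otimes> t))"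
      using assms c by (simp add: m_ac l_distr r_distr)
    also have "\<dots> = (v \<otimes> t' \<otimes> t) \<otimes> (u \<otimes> (a \<otimes> s')) \<oplus> (u \<otimes> s' \<otimes> s) \<otimes> (v \<otimes> (b \<otimes> t'))"
      by (simp add: u v)
    also have "\<dots> = (u \<otimes> v) \<otimes> ((a \<otimes> t \<oplus> b \<otimes> s) \<otimes> (s' \<otimes> t'))"
      using assms c by (simp add: m_ac l_distr r_distr)
    finally show ?thesis using assms c S_mult by (intro fraction_eqI[of _ _ _ _ "u \<otimes> v"]) auto
  qed
  have "frac a s \<oplus>\<^bsub>L\<^esub> frac b t
      = (\<Union>(a', s')\<in>frac a s. \<Union>(b', t')\<in>frac b t. frac (a' \<otimes> t' \<oplus> b' \<otimes> s') (s' \<otimes> t'))"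
    unfolding localization_def by simp
  also have "\<dots> = (\<Union>x\<in>frac a s. \<Union>y\<in>frac b t. frac (a \<otimes> t \<oplus> b \<otimes> s) (s \<otimes> t))"
    by (intro SUP_cong refl) (auto simp: *)
  also have "\<dots> = frac (a \<otimes> t \<oplus> b \<otimes> s) (s \<otimes> t)"
    using fraction_refl[OF assms(1,2)] fraction_refl[OF assms(3,4)] by auto
  finally show ?thesis .
qed

lemma frac_closed: "a \<in> carrier R \<Longrightarrow> s \<in> S \<Longrightarrow> frac a s \<in> carrier L"
  unfolding localization_def by auto

lemma loc_cases:
  assumes "X \<in> carrier L"
  obtains a s where "a \<in> carrier R" "s \<in> S" "X = frac a s"
  using assms unfolding localization_def by auto

lemma loc_one: "\<one>\<^bsub>L\<^esub> = frac \<one> \<one>" and loc_zero: "\<zero>\<^bsub>L\<^esub> = frac \<zero> \<one>"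
  unfolding localization_def by auto

lemma frac_self: "s \<in> S \<Longrightarrow> frac s s = \<one>\<^bsub>L\<^esub>"
  unfolding loc_one using S_one by (intro fraction_eqI[of _ _ _ _ \<one>]) auto

lemma frac_zero: "s \<in> S \<Longrightarrow> frac \<zero> s = \<zero>\<^bsub>L\<^esub>"
  unfolding loc_zero using S_one by (intro fraction_eqI[of _ _ _ _ \<one>]) auto

theorem localization_cring: "cring L"
proof (intro cringI abelian_groupI comm_monoidI)
  note mult = frac_mult frac_add frac_closed S_mult
  note norm = l_distr r_distr m_ac a_ac
  show "\<zero>\<^bsub>L\<^esub> \<in> carrier L" "\<one>\<^bsub>L\<^esub> \<in> carrier L"
    unfolding loc_zero loc_one using S_one by (auto intro: frac_closed)
  fix X assume "X \<in> carrier L"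
  then obtain a s where a: "a \<in> carrier R" "s \<in> S" "X = frac a s" by (rule loc_cases)
  show "\<zero>\<^bsub>L\<^esub> \<oplus>\<^bsub>L\<^esub> X = X" "\<one>\<^bsub>L\<^esub> \<otimes>\<^bsub>L\<^esub> X = X"
    unfolding loc_zero loc_one a(3) using a(1,2) S_one by (simp_all add: mult)
  show "\<exists>Y\<in>carrier L. Y \<oplus>\<^bsub>L\<^esub> X = \<zero>\<^bsub>L\<^esub>"
  proof
    show "frac (\<ominus> a) s \<in> carrier L" using a by (intro frac_closed) auto
    show "frac (\<ominus> a) s \<oplus>\<^bsub>L\<^esub> X = \<zero>\<^bsub>L\<^esub>"
      using a by (simp add: mult l_minus l_neg frac_zero)
  qed
  fix Y assume "Y \<in> carrier L"
  then obtain b t where b: "b \<in> carrier R" "t \<in> S" "Y = frac b t" by (rule loc_cases)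
  show "X \<oplus>\<^bsub>L\<^esub> Y \<in> carrier L" "X \<otimes>\<^bsub>L\<^esub> Y \<in> carrier L"
    using a b by (simp_all add: mult)
  show "X \<oplus>\<^bsub>L\<^esub> Y = Y \<oplus>\<^bsub>L\<^esub> X" "X \<otimes>\<^bsub>L\<^esub> Y = Y \<otimes>\<^bsub>L\<^esub> X"
    using a b by (simp_all add: mult norm)
  fix Z assume "Z \<in> carrier L"
  then obtain c v where c: "c \<in> carrier R" "v \<in> S" "Z = frac c v" by (rule loc_cases)
  show "X \<oplus>\<^bsub>L\<^esub> Y \<oplus>\<^bsub>L\<^esub> Z = X \<oplus>\<^bsub>L\<^esub> (Y \<oplus>\<^bsub>L\<^esub> Z)" "X \<otimes>\<^bsub>L\<^esub> Y \<otimes>\<^bsub>L\<^esub> Z = X \<otimes>\<^bsub>L\<^esub> (Y \<otimes>\<^bsub>L\<^esub> Z)"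
    using a b c by (simp_all add: mult norm)
  \<comment> \<open>Adding the two products leaves a surplus factor \<open>v\<close> in numerator
    and denominator, so the two sides agree as classes but not as formal fractions.\<close>
  have "frac ((a \<otimes> t \<oplus> b \<otimes> s) \<otimes> c) ((s \<otimes> t) \<otimes> v)
      = frac ((a \<otimes> c) \<otimes> (t \<otimes> v) \<oplus> (b \<otimes> c) \<otimes> (s \<otimes> v)) ((s \<otimes> v) \<otimes> (t \<otimes> v))"
    using a b c S_one S_mult by (intro fraction_eqI[of _ _ _ _ \<one>]) (auto simp: norm)
  then show "(X \<oplus>\<^bsub>L\<^esub> Y) \<otimes>\<^bsub>L\<^esub> Z = X \<otimes>\<^bsub>L\<^esub> Z \<oplus>\<^bsub>L\<^esub> Y \<otimes>\<^bsub>L\<^esub> Z"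
    using a b c by (simp add: mult)
qed

end

section \<open>Extending ideals to the localization at a prime\<close>

context noetherian_cring
begin

lemma cring_with_denominators_prime:
  assumes "primeideal p R"
  shows "cring_with_denominators R (carrier R - p)"
  using prime_complement_closed[OF assms]
  by unfold_locales auto

text \<open>An element of \<open>J\<close> outside \<open>p\<close> becomes a unit. This turns the
  properness clause of \<open>coeff_extensions\<close> into a containment in
  \<open>p\<close>.\<close>

lemma loc_ideal_proper_imp_subset:
  assumes p: "primeideal p R" and J: "ideal J R"
    and proper: "loc_ideal R p J \<noteq> carrier (loc_at R p)"
  shows "J \<subseteq> p"
proof (rule ccontr)
  interpret D: cring_with_denominators R "carrier R - p" by (rule cring_with_denominators_prime[OF p])
  interpret L: cring D.L by (rule D.localization_cring)
  assume "\<not> J \<subseteq> p"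
  then obtain x where x: "x \<in> J" "x \<in> carrier R - p" using ideal.Icarr[OF J] by blast
  let ?G = "(\<lambda>a. D.frac a \<one>) ` J"
  have G: "?G \<subseteq> carrier D.L" using D.frac_closed D.S_one ideal.Icarr[OF J] by auto
  interpret I: ideal "Idl\<^bsub>D.L\<^esub> ?G" D.L by (rule L.genideal_ideal[OF G])
  have "D.frac x \<one> \<in> Idl\<^bsub>D.L\<^esub> ?G" using L.genideal_self[OF G] x by auto
  moreover have "D.frac \<one> x \<in> carrier D.L" using x by (intro D.frac_closed) auto
  ultimately have "D.frac \<one> x \<otimes>\<^bsub>D.L\<^esub> D.frac x \<one> \<in> Idl\<^bsub>D.L\<^esub> ?G" by (rule I.I_l_closed)
  also have "D.frac \<one> x \<otimes>\<^bsub>D.L\<^esub> D.frac x \<one> = \<one>\<^bsub>D.L\<^esub>"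
    using x D.S_one by (simp add: D.frac_mult D.frac_self)
  finally show False
    using I.one_imp_carrier proper unfolding loc_ideal_def loc_at_def by blast
qed

text \<open>For \<open>x\<close> in the unmixed part there is \<open>s\<close> outside
  \<open>p\<close> with \<open>s \<otimes> x \<in> J\<close>, and x/1 = (1/s)(sx/1) lies in the
  extension of \<open>J\<close>.\<close>

lemma loc_ideal_unmixed_part:
  assumes J: "ideal J R" and p: "p \<in> min_primes R J"
  shows "loc_ideal R p (unmixed_part R J) = loc_ideal R p J"
proof -
  have pp: "primeideal p R" using min_primesD(1)[OF p] .
  interpret D: cring_with_denominators R "carrier R - p" by (rule cring_with_denominators_prime[OF pp])
  interpret L: cring D.L by (rule D.localization_cring)
  let ?f = "\<lambda>a. D.frac a \<one>"
  have Jc: "?f ` J \<subseteq> carrier D.L" using D.frac_closed D.S_one ideal.Icarr[OF J] by auto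
  have "?f ` unmixed_part R J \<subseteq> Idl\<^bsub>D.L\<^esub> (?f ` J)"
  proof safe
    interpret I: ideal "Idl\<^bsub>D.L\<^esub> (?f ` J)" D.L by (rule L.genideal_ideal[OF Jc])
    fix x assume "x \<in> unmixed_part R J"
    then obtain s where s: "x \<in> carrier R" "s \<in> carrier R - p" "s \<otimes> x \<in> J"
      unfolding unmixed_part_eq[OF J] using p by blast
    have "?f (s \<otimes> x) \<in> Idl\<^bsub>D.L\<^esub> (?f ` J)" using L.genideal_self[OF Jc] s by auto
    moreover have "D.frac \<one> s \<in> carrier D.L" using s by (intro D.frac_closed) auto
    ultimately have "D.frac \<one> s \<otimes>\<^bsub>D.L\<^esub> ?f (s \<otimes> x) \<in> Idl\<^bsub>D.L\<^esub> (?f ` J)" by (rule I.I_l_closed)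
    also have "D.frac \<one> s \<otimes>\<^bsub>D.L\<^esub> ?f (s \<otimes> x) = D.frac (s \<otimes> x) s"
      using s D.S_one by (simp add: D.frac_mult)
    also have "\<dots> = ?f x"
      using s D.S_one by (intro D.fraction_eqI[of _ _ _ _ \<one>]) (auto simp: m_ac)
    finally show "?f x \<in> Idl\<^bsub>D.L\<^esub> (?f ` J)" .
  qed
  then have "Idl\<^bsub>D.L\<^esub> (?f ` unmixed_part R J) \<subseteq> Idl\<^bsub>D.L\<^esub> (?f ` J)"
    using L.genideal_minimal[OF L.genideal_ideal[OF Jc]] by blast
  moreover have "Idl\<^bsub>D.L\<^esub> (?f ` J) \<subseteq> Idl\<^bsub>D.L\<^esub> (?f ` unmixed_part R J)"
    unfolding genideal_def using subset_unmixed_part[OF J] by blast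
  ultimately show ?thesis unfolding loc_ideal_def loc_at_def by blast
qed

section \<open>Coefficient ideals\<close>

text \<open>Properness at each minimal prime \<open>p\<close> of \<open>J\<close> gives
  \<open>L \<subseteq> p\<close>, which is what \<open>min_primes_eqI\<close> asks for.\<close>

lemma min_primes_coeff_extension:
  assumes J: "ideal J R" and L: "L \<in> coeff_extensions R J k"
  shows "min_primes R L = min_primes R J"
  using L loc_ideal_proper_imp_subset[OF min_primesD(1)] unfolding coeff_extensions_def
  by (intro min_primes_eqI[OF J]) auto

text \<open>\<open>loc_ideal_unmixed_part\<close> for \<open>L\<close> speaks of minimal primes of
  \<open>L\<close>; since these are the minimal primes of \<open>J\<close>, every clause of
  \<open>coeff_extensions\<close> carries over from \<open>L\<close>.\<close>

lemma unmixed_part_coeff_extension: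
  assumes J: "ideal J R" and L: "L \<in> coeff_extensions R J k"
  shows "unmixed_part R L \<in> coeff_extensions R J k"
proof -
  have LI: "ideal L R" using L unfolding coeff_extensions_def by auto
  have "loc_ideal R p (unmixed_part R L) = loc_ideal R p L" if "p \<in> min_primes R J" for p
    using loc_ideal_unmixed_part[OF LI] min_primes_coeff_extension[OF assms] that by simp
  then show ?thesis
    using L unmixed_part_ideal[OF LI] subset_unmixed_part[OF LI]
    unfolding coeff_extensions_def by auto
qed

text \<open>Neither the indexing primes nor the localizations of \<open>J\<close> at them change, so
  the containment clause alone becomes stronger.\<close>

lemma coeff_extensions_unmixed_part:
  assumes J: "ideal J R"
  shows "coeff_extensions R (unmixed_part R J) k =
    {L \<in> coeff_extensions R J k. unmixed_part R J \<subseteq> L}"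
  using subset_unmixed_part[OF J] loc_ideal_unmixed_part[OF J]
  unfolding coeff_extensions_def min_primes_unmixed_part[OF J] by auto

lemma coeff_ideal_unmixed_part:
  assumes J: "ideal J R" and L: "is_coeff_ideal R J k L"
  shows "unmixed_part R L = L" "is_coeff_ideal R (unmixed_part R J) k L"
proof -
  have ext: "L \<in> coeff_extensions R J k" using L unfolding is_coeff_ideal_def by blast
  then have LI: "ideal L R" "J \<subseteq> L" unfolding coeff_extensions_def by auto
  show eq: "unmixed_part R L = L"
    using unmixed_part_coeff_extension[OF J ext] L subset_unmixed_part[OF LI(1)]
    unfolding is_coeff_ideal_def by blast
  have "unmixed_part R J \<subseteq> L"
    using unmixed_part_mono[OF J LI min_primes_coeff_extension[OF J ext]] eq by simp
  \<comment> \<open>The smaller family of extensions still contains \<open>L\<close>, so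
    \<open>L\<close> remains its largest member.\<close>
  then show "is_coeff_ideal R (unmixed_part R J) k L"
    using L unfolding is_coeff_ideal_def coeff_extensions_unmixed_part[OF J] by blast
qed

end

theorem theorem2p14:
  fixes R :: "('a, 'b) ring_scheme" and m I :: "'a set"
  assumes "noetherian_local_ring R m"
    and "quasi_unmixed R m"
    and "infinite (carrier (R Quot m))"
    and "krull_dim R \<ge> 1"
    and "equimultiple R m I"
  shows "\<forall>k L. 1 \<le> k \<and> enat k \<le> analytic_spread R m I \<and> is_coeff_ideal R I k L \<longrightarrow>
           is_coeff_ideal R (unmixed_part R I) k (unmixed_part R L) \<and> unmixed_ideal R L"
proof (intro allI impI)
  fix k L
  assume "1 \<le> k \<and> enat k \<le> analytic_spread R m I \<and> is_coeff_ideal R I k L"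
  then have L: "is_coeff_ideal R I k L" by blast
  interpret noetherian_local_ring R m by fact
  interpret noetherian_cring R ..
  have I: "ideal I R" using assms(5) unfolding equimultiple_def by blast
  have "ideal L R" using L unfolding is_coeff_ideal_def coeff_extensions_def by blast
  \<comment> \<open>Since \<open>unmixed_part R L\<close> equals \<open>L\<close>, the first
    conjunct only asks that \<open>L\<close> be the coefficient ideal of
    \<open>unmixed_part R I\<close>.\<close>
  then show "is_coeff_ideal R (unmixed_part R I) k (unmixed_part R L) \<and> unmixed_ideal R L"
    using coeff_ideal_unmixed_part[OF I L] unfolding unmixed_ideal_def by simp
qed

end
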